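(* Let $X$ be a nonempty second-countable Hausdorff regular space, let $S$ be a proper dyadic subbase of $X$, and let $D$ be either $D_S$ or $\widehat{D}_S$. (1) In the dense domain representation $(D,\widetilde{X},\varphi_S^{-1})$ of $X$, we have $\widetilde{X}\subseteq\min(L(D))$. In particular, if $X$ is compact, then $\widetilde{X}=\min(L(D))$. (2) In the retract domain representation $(D,\uparrow\widetilde{X},\rho_S)$ of $X$, where $\uparrow\widetilde{X}$ is the upwards-closure of $\widetilde{X}$ in $D$, the set $\uparrow\widetilde{X}$ is downwards-closed in $L(D)$ (i.e. if $p\in\uparrow\widetilde{X}$, $q\in L(D)$ and $q\sqsubseteq p$, then $q\in\uparrow\widetilde{X}$). In particular, if $X$ is compact, then $\uparrow\widetilde{X}=L(D)$.
   Context: $\mathbb{T}=\{0,1,\bot\}$ is ordered by $\bot\sqsubseteq 0$, $\bot\sqsubseteq 1$, and $\mathbb{T}^\omega$ (infinite sequences over $\mathbb{T}$) carries the product order $\sqsubseteq$. For $p\in\mathbb{T}^\omega$, $\mathrm{dom}(p)=\{k: p(k)\neq\bot\}$; $\mathbb{T}^*$ is the set of $p\in\mathbb{T}^\omega$ with $\mathrm{dom}(p)$ finite. For $m\in\mathbb{N}$, $p|_m\in\mathbb{T}^*$ is defined by $p|_m(k)=p(k)$ if $k<m$ and $p|_m(k)=\bot$ if $k\ge m$. A dyadic subbase of $X$ is a family $S=\{S_{n,a}: n\in\mathbb{N}, a\in\{0,1\}\}$ of regular open sets (open sets equal to the interior of their closure) that forms a subbase of $X$ and such that $S_{n,1}$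 is the exterior (complement of the closure) of $S_{n,0}$ for each $n$. Put $S_{n,\bot}=X\setminus(S_{n,0}\cup S_{n,1})$. For $x\in X$, $\varphi_S(x)=\tilde{x}\in\mathbb{T}^\omega$ is given by $\tilde{x}(n)=c$ iff $x\in S_{n,c}$ ($c\in\mathbb{T}$), and $\widetilde{X}=\varphi_S(X)$; $\varphi_S$ is injective. For $p\in\mathbb{T}^\omega$, $S(p)=\bigcap_{k\in\mathrm{dom}(p)}S_{k,p(k)}$ and $\bar{S}(p)=\bigcap_{k\in\mathrm{dom}(p)}\mathrm{cl}\,S_{k,p(k)}$ (empty intersection is $X$). $S$ is proper if $\mathrm{cl}\,S(e)=\bar{S}(e)$ for every $e\in\mathbb{T}^*$. For proper $S$ and $p\in\mathbb{T}^\omega$ with $p\sqsupseteq\tilde{x}$ for some $x\in X$, the set $\bar{S}(p)$ is a singleton and $\rho_S(p)$ denotes its unique element. Let $U=\{p\in\mathbb{T}^\omega: p\sqsupseteq\tilde{x}\text{ for some }x\in X\}$. Define the posets $K_S=\{p|_m:p\in\widetilde{X},m\in\mathbb{N}\}$ and $\widehat{K}_S=\{p|_m:p\in U,m\in\mathbb{N}\}$ (subsets of $\mathbb{T}^*$), and let $D_S=\mathrm{Idl}(K_S)$, $\widehat{D}_S=\mathrm{Idl}(\widehat{K}_S)$ be their ideal completions (ideals, i.e. directed downwards-closed subsets, ordered by inclusion), with the Scott topology. Via $I\mapsto\bigsqcup I$ (supremum in $\mathbb{T}^\omega$) they are regarded as subposets of $\mathbb{T}^\omega$ (containing $\widetilde{X}$);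 the sets of compact elements are $K_S$ and $\widehat{K}_S$. For a domain (an $\omega$-algebraic pointed dcpo) $D$, $L(D)$ is the set of non-compact elements. For a poset $P$, $\min(P)$ is the set of minimal elements. A domain representation of $X$ is a triple $(D,D^R,\mu)$ with $D$ a domain, $D^R$ a subspace of $D$, and $\mu$ a quotient map from $D^R$ onto $X$; it is dense if $D^R$ is dense in $D$, and a retract domain representation if $\mu$ is a retraction (has a continuous right inverse). *)

theory Defs
  imports "HOL-Analysis.Analysis" "HOL-Library.Lub_Glb"
begin

section \<open>Posets and domains\<close>

text \<open>
  A poset is given by a carrier set \<open>P\<close> in a type of class \<open>order\<close>. Least upper bounds are always
  taken inside \<open>P\<close>: \<open>isLub P A s\<close> says that \<open>s\<close> is the least among the upper bounds of \<open>A\<close> that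
  lie in \<open>P\<close>.
\<close>

definition directed_in :: "'a::order set \<Rightarrow> 'a set \<Rightarrow> bool" where
  "directed_in P A \<longleftrightarrow> A \<subseteq> P \<and> A \<noteq> {} \<and> (\<forall>a\<in>A. \<forall>b\<in>A. \<exists>c\<in>A. a \<le> c \<and> b \<le> c)"

definition down_closed_in :: "'a::order set \<Rightarrow> 'a set \<Rightarrow> bool" where
  "down_closed_in P A \<longleftrightarrow> (\<forall>a\<in>A. \<forall>b\<in>P. b \<le> a \<longrightarrow> b \<in> A)"

definition up_closure_in :: "'a::order set \<Rightarrow> 'a set \<Rightarrow> 'a set" where
  "up_closure_in P A = {p \<in> P. \<exists>a\<in>A. a \<le> p}"

definition minimals :: "'a::order set \<Rightarrow> 'a set" where
  "minimals P = {x \<in> P. \<forall>y\<in>P. y \<le> x \<longrightarrow> y = x}"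

definition ideals :: "'a::order set \<Rightarrow> 'a set set" where
  "ideals P = {I. directed_in P I \<and> down_closed_in P I}"

definition dcpo :: "'a::order set \<Rightarrow> bool" where
  "dcpo P \<longleftrightarrow> (\<forall>A. directed_in P A \<longrightarrow> (\<exists>s. isLub P A s))"

definition pointed :: "'a::order set \<Rightarrow> bool" where
  "pointed P \<longleftrightarrow> (\<exists>b\<in>P. \<forall>x\<in>P. b \<le> x)"

definition compact_elems :: "'a::order set \<Rightarrow> 'a set" where
  "compact_elems P =
     {c \<in> P. \<forall>A s. directed_in P A \<longrightarrow> isLub P A s \<longrightarrow> c \<le> s \<longrightarrow> (\<exists>a\<in>A. c \<le> a)}"

definition noncompact_elems :: "'a::order set \<Rightarrow> 'a set" where
  "noncompact_elems P = P - compact_elems P"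

definition omega_algebraic :: "'a::order set \<Rightarrow> bool" where
  "omega_algebraic P \<longleftrightarrow> countable (compact_elems P) \<and>
     (\<forall>x\<in>P. directed_in P {c \<in> compact_elems P. c \<le> x} \<and>
             isLub P {c \<in> compact_elems P. c \<le> x} x)"

definition omega_domain :: "'a::order set \<Rightarrow> bool" where
  "omega_domain P \<longleftrightarrow> dcpo P \<and> pointed P \<and> omega_algebraic P"

definition scott_open :: "'a::order set \<Rightarrow> 'a set \<Rightarrow> bool" where
  "scott_open P U \<longleftrightarrow> U \<subseteq> P \<and> (\<forall>x\<in>U. \<forall>y\<in>P. x \<le> y \<longrightarrow> y \<in> U) \<and>
     (\<forall>A s. directed_in P A \<longrightarrow> isLub P A s \<longrightarrow> s \<in> U \<longrightarrow> A \<inter> U \<noteq> {})"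

definition scott_topology :: "'a::order set \<Rightarrow> 'a topology" where
  "scott_topology P = topology (scott_open P)"

lemma istopology_scott_open: "istopology (scott_open P)"
  unfolding istopology_def
proof (intro conjI allI impI)
  fix U V
  assume U: "scott_open P U" and V: "scott_open P V"
  show "scott_open P (U \<inter> V)"
    unfolding scott_open_def
  proof (intro conjI ballI allI impI)
    show "U \<inter> V \<subseteq> P"
      using U by (auto simp: scott_open_def)
    show "y \<in> U \<inter> V" if "x \<in> U \<inter> V" "y \<in> P" "x \<le> y" for x y
      using U V that by (auto simp: scott_open_def)
    fix A s
    assume A: "directed_in P A" and s: "isLub P A s" "s \<in> U \<inter> V"
    have "A \<inter> U \<noteq> {}" "A \<inter> V \<noteq> {}"
      using U V A s by (auto simp: scott_open_def)
    then obtain a b where ab: "a \<in> A" "a \<in> U" "b \<in> A" "b \<in> V"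
      by auto
    obtain c where c: "c \<in> A" "a \<le> c" "b \<le> c"
      using A ab(1,3) unfolding directed_in_def by metis
    have "c \<in> P"
      using A c by (auto simp: directed_in_def)
    then have "c \<in> U" "c \<in> V"
      using ab c U V by (auto simp: scott_open_def)
    then show "A \<inter> (U \<inter> V) \<noteq> {}"
      using c by auto
  qed
next
  fix \<U>
  assume *: "\<forall>U\<in>\<U>. scott_open P U"
  show "scott_open P (\<Union>\<U>)"
    unfolding scott_open_def
  proof (intro conjI ballI allI impI)
    show "\<Union>\<U> \<subseteq> P"
      using * by (auto simp: scott_open_def)
  next
    fix x y assume "x \<in> \<Union>\<U>" and y: "y \<in> P" "x \<le> y"
    then obtain U where "U \<in> \<U>" "x \<in> U"
      by auto
    moreover from this have "y \<in> U"
      using * y by (auto simp: scott_open_def)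
    ultimately show "y \<in> \<Union>\<U>"
      by auto
  next
    fix A s assume A: "directed_in P A" "isLub P A s" and "s \<in> \<Union>\<U>"
    then obtain U where "U \<in> \<U>" "s \<in> U"
      by auto
    moreover from this have "A \<inter> U \<noteq> {}"
      using * A by (auto simp: scott_open_def)
    ultimately show "A \<inter> \<Union>\<U> \<noteq> {}"
      by auto
  qed
qed

lemma openin_scott_topology: "openin (scott_topology P) U \<longleftrightarrow> scott_open P U"
  by (simp add: scott_topology_def istopology_scott_open)

lemma topspace_scott_topology [simp]: "topspace (scott_topology P) = P"
proof (rule antisym)
  show "topspace (scott_topology P) \<subseteq> P"
    unfolding topspace_def by (auto simp: openin_scott_topology scott_open_def)
  have "scott_open P P"
    by (auto simp: scott_open_def directed_in_def)
  then show "P \<subseteq> topspace (scott_topology P)"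
    by (simp add: openin_scott_topology openin_subset)
qed


section \<open>Domain representations\<close>

definition domain_representation ::
  "'b::order set \<Rightarrow> 'b set \<Rightarrow> ('b \<Rightarrow> 'a) \<Rightarrow> 'a topology \<Rightarrow> bool" where
  "domain_representation D R \<mu> X \<longleftrightarrow>
     omega_domain D \<and> R \<subseteq> D \<and> quotient_map (subtopology (scott_topology D) R) X \<mu>"

definition dense_domain_representation ::
  "'b::order set \<Rightarrow> 'b set \<Rightarrow> ('b \<Rightarrow> 'a) \<Rightarrow> 'a topology \<Rightarrow> bool" where
  "dense_domain_representation D R \<mu> X \<longleftrightarrow>
     domain_representation D R \<mu> X \<and> scott_topology D closure_of R = D"

definition retract_domain_representation ::
  "'b::order set \<Rightarrow> 'b set \<Rightarrow> ('b \<Rightarrow> 'a) \<Rightarrow> 'a topology \<Rightarrow> bool" where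
  "retract_domain_representation D R \<mu> X \<longleftrightarrow>
     domain_representation D R \<mu> X \<and> retraction_map (subtopology (scott_topology D) R) X \<mu>"


section \<open>Sequences over $\{0,1,\bot\}$\<close>

text \<open>The digits 0 and 1 are \<open>Dig False\<close> and \<open>Dig True\<close>.\<close>

datatype trit = Bot | Dig bool

instantiation trit :: order
begin

definition less_eq_trit :: "trit \<Rightarrow> trit \<Rightarrow> bool" where
  "less_eq_trit a b \<longleftrightarrow> a = Bot \<or> a = b"

definition less_trit :: "trit \<Rightarrow> trit \<Rightarrow> bool" where
  "less_trit a b \<longleftrightarrow> a \<le> b \<and> \<not> b \<le> (a::trit)"

instance
  by intro_classes (auto simp: less_eq_trit_def less_trit_def)

end

text \<open>The product order on sequences is the pointwise order that HOL puts on function types.\<close>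

type_synonym tseq = "nat \<Rightarrow> trit"

definition tdom :: "tseq \<Rightarrow> nat set" where
  "tdom p = {k. p k \<noteq> Bot}"

definition tfin :: "tseq set" where
  "tfin = {p. finite (tdom p)}"

definition trunc :: "tseq \<Rightarrow> nat \<Rightarrow> tseq" where
  "trunc p m = (\<lambda>k. if k < m then p k else Bot)"


section \<open>Dyadic subbases\<close>

definition regular_open_in :: "'a topology \<Rightarrow> 'a set \<Rightarrow> bool" where
  "regular_open_in X U \<longleftrightarrow> openin X U \<and> X interior_of (X closure_of U) = U"

text \<open>
  The open sets are the unions of finite intersections of members of \<open>\<B>\<close>, the empty intersection
  being the whole space.
\<close>

definition subbase_of :: "'a topology \<Rightarrow> 'a set set \<Rightarrow> bool" where
  "subbase_of X \<B> \<longleftrightarrow>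
     openin X = arbitrary union_of (finite intersection_of (\<lambda>U. U \<in> \<B>) relative_to topspace X)"

definition dyadic_subbase :: "'a topology \<Rightarrow> (nat \<Rightarrow> bool \<Rightarrow> 'a set) \<Rightarrow> bool" where
  "dyadic_subbase X S \<longleftrightarrow>
     (\<forall>n a. regular_open_in X (S n a)) \<and>
     subbase_of X {S n a | n a. True} \<and>
     (\<forall>n. S n True = topspace X - X closure_of (S n False))"

definition cell :: "'a topology \<Rightarrow> (nat \<Rightarrow> bool \<Rightarrow> 'a set) \<Rightarrow> nat \<Rightarrow> trit \<Rightarrow> 'a set" where
  "cell X S n c = (case c of Dig a \<Rightarrow> S n a | Bot \<Rightarrow> topspace X - (S n False \<union> S n True))"

definition phi :: "'a topology \<Rightarrow> (nat \<Rightarrow> bool \<Rightarrow> 'a set) \<Rightarrow> 'a \<Rightarrow> tseq" where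
  "phi X S x = (\<lambda>n. THE c. x \<in> cell X S n c)"

definition Xtilde :: "'a topology \<Rightarrow> (nat \<Rightarrow> bool \<Rightarrow> 'a set) \<Rightarrow> tseq set" where
  "Xtilde X S = phi X S ` topspace X"

text \<open>The intersection with \<open>topspace X\<close> matters only when the domain of \<open>p\<close> is empty.\<close>

definition Sopen :: "'a topology \<Rightarrow> (nat \<Rightarrow> bool \<Rightarrow> 'a set) \<Rightarrow> tseq \<Rightarrow> 'a set" where
  "Sopen X S p = topspace X \<inter> (\<Inter>k\<in>tdom p. cell X S k (p k))"

definition Sclosed :: "'a topology \<Rightarrow> (nat \<Rightarrow> bool \<Rightarrow> 'a set) \<Rightarrow> tseq \<Rightarrow> 'a set" where
  "Sclosed X S p = topspace X \<inter> (\<Inter>k\<in>tdom p. X closure_of (cell X S k (p k)))"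

definition proper_dyadic_subbase :: "'a topology \<Rightarrow> (nat \<Rightarrow> bool \<Rightarrow> 'a set) \<Rightarrow> bool" where
  "proper_dyadic_subbase X S \<longleftrightarrow>
     dyadic_subbase X S \<and> (\<forall>e\<in>tfin. X closure_of (Sopen X S e) = Sclosed X S e)"

definition rho :: "'a topology \<Rightarrow> (nat \<Rightarrow> bool \<Rightarrow> 'a set) \<Rightarrow> tseq \<Rightarrow> 'a" where
  "rho X S p = the_elem (Sclosed X S p)"

definition K_S :: "'a topology \<Rightarrow> (nat \<Rightarrow> bool \<Rightarrow> 'a set) \<Rightarrow> tseq set" where
  "K_S X S = {trunc p m | p m. p \<in> Xtilde X S}"

definition Khat_S :: "'a topology \<Rightarrow> (nat \<Rightarrow> bool \<Rightarrow> 'a set) \<Rightarrow> tseq set" where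
  "Khat_S X S = {trunc p m | p m. p \<in> up_closure_in UNIV (Xtilde X S)}"


section \<open>Ideal completions inside the sequences\<close>

text \<open>
  The ideal completion of a poset \<open>K\<close> of finite sequences, regarded as a subposet of the poset of
  all sequences by sending an ideal to its supremum there. Lemmas \<open>ideal_has_sup\<close> and
  \<open>ideal_sup_le_iff\<close> below show that for
  \<open>K \<subseteq> tfin\<close> this is an isomorphism from the ideals of \<open>K\<close>, ordered by inclusion, onto
  \<open>ideal_completion K\<close>.
\<close>

definition ideal_completion :: "tseq set \<Rightarrow> tseq set" where
  "ideal_completion K = {p. \<exists>I\<in>ideals K. isLub UNIV I p}"

lemma isLub_UNIV_iff:
  fixes p :: "'a::order"
  shows "isLub UNIV I p \<longleftrightarrow> (\<forall>e\<in>I. e \<le> p) \<and> (\<forall>q. (\<forall>e\<in>I. e \<le> q) \<longrightarrow> p \<le> q)"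
  by (auto simp: isLub_def leastP_def isUb_def setle_def setge_def)

lemma ideal_has_sup:
  assumes "I \<in> ideals K"
  shows "\<exists>!p::tseq. isLub UNIV I p"
proof (rule ex_ex1I)
  define p where "p k = (if \<exists>e\<in>I. e k \<noteq> Bot then SOME c. c \<noteq> Bot \<and> (\<exists>e\<in>I. e k = c) else Bot)" for k
  have p: "\<exists>e\<in>I. e k = p k" if "p k \<noteq> Bot" for k
    using that someI_ex[of "\<lambda>c. c \<noteq> Bot \<and> (\<exists>e\<in>I. e k = c)"]
    by (auto simp: p_def split: if_splits)
  have p': "p k \<noteq> Bot" if "e \<in> I" "e k \<noteq> Bot" for e k
    using that someI_ex[of "\<lambda>c. c \<noteq> Bot \<and> (\<exists>e\<in>I. e k = c)"]
    by (auto simp: p_def)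
  have "e k \<le> p k" if e: "e \<in> I" for e k
  proof (cases "e k = Bot")
    case False
    then obtain d where d: "d \<in> I" "d k = p k"
      using p p' e by blast
    then obtain c where "c \<in> I" "e \<le> c" "d \<le> c"
      using assms e unfolding ideals_def directed_in_def by blast
    then have "e k = c k" "d k = c k"
      using False d p'[OF e False] le_funD[of e c k] le_funD[of d c k]
      by (auto simp: less_eq_trit_def)
    then show ?thesis
      using d by simp
  qed (simp add: less_eq_trit_def)
  moreover have "p k \<le> q k" if "\<forall>e\<in>I. e \<le> q" for q k
    using p[of k] that by (metis le_funD less_eq_trit_def)
  ultimately show "\<exists>p. isLub UNIV I p"
    unfolding isLub_UNIV_iff by (auto simp: le_fun_def intro!: exI[of _ p])
next
  show "p = q" if "isLub UNIV I p" "isLub UNIV I q" for p q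
    using that unfolding isLub_UNIV_iff by (auto intro: antisym)
qed

lemma ideal_sup_le_iff:
  assumes "K \<subseteq> tfin" "I \<in> ideals K" "J \<in> ideals K" "isLub UNIV I p" "isLub UNIV J q"
  shows "p \<le> q \<longleftrightarrow> I \<subseteq> J"
proof
  assume "I \<subseteq> J"
  then show "p \<le> q"
    using assms unfolding isLub_UNIV_iff by blast
next
  assume "p \<le> q"
  show "I \<subseteq> J"
  proof
    fix e assume e: "e \<in> I"
    have eq: "e \<le> q"
      using e \<open>p \<le> q\<close> assms(4) unfolding isLub_UNIV_iff by (meson order_trans)
    have eK: "e \<in> K"
      using e assms unfolding ideals_def directed_in_def by blast
    have J: "J \<noteq> {}" "\<And>a b. a \<in> J \<Longrightarrow> b \<in> J \<Longrightarrow> \<exists>c\<in>J. a \<le> c \<and> b \<le> c"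
      using assms(3) unfolding ideals_def directed_in_def by blast+
    have hit: "\<exists>j\<in>J. e k \<le> j k" for k
    proof (cases "e k = Bot")
      case True
      then show ?thesis
        using J(1) by (auto simp: less_eq_trit_def)
    next
      case False
      then have qk: "q k = e k"
        using le_funD[OF eq, of k] by (simp add: less_eq_trit_def)
      show ?thesis
      proof (rule ccontr)
        assume "\<not> ?thesis"
        then have n: "\<And>j. j \<in> J \<Longrightarrow> j k \<noteq> e k"
          by (auto simp: less_eq_trit_def)
        have ub: "\<And>j. j \<in> J \<Longrightarrow> j \<le> q"
          using assms(5) unfolding isLub_UNIV_iff by blast
        have "j \<le> q(k := Bot)" if "j \<in> J" for j
        proof (rule le_funI)
          show "j i \<le> (q(k := Bot)) i" for i
            using n[OF that] le_funD[OF ub[OF that], of i] qk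
            by (cases "i = k") (auto simp: less_eq_trit_def)
        qed
        then have "q \<le> q(k := Bot)"
          using assms(5) unfolding isLub_UNIV_iff by blast
        then have "q k \<le> Bot"
          by (metis fun_upd_same le_funD)
        then show False
          using qk False by (simp add: less_eq_trit_def)
      qed
    qed
    have "finite F \<Longrightarrow> \<exists>j\<in>J. \<forall>k\<in>F. e k \<le> j k" for F
    proof (induction F rule: finite_induct)
      case empty
      then show ?case using J(1) by blast
    next
      case (insert k F)
      then obtain i j where "i \<in> J" "\<forall>k\<in>F. e k \<le> i k" "j \<in> J" "e k \<le> j k"
        using hit by blast
      then show ?case
        using J(2)[of i j] by (metis insert_iff le_funD order_trans)
    qed
    moreover have "finite (tdom e)"
      using eK assms(1) by (auto simp: tfin_def)
    ultimately obtain j where j: "j \<in> J" "\<forall>k\<in>tdom e. e k \<le> j k"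
      by blast
    have "e \<le> j"
    proof (rule le_funI)
      show "e k \<le> j k" for k
        using j(2) by (cases "e k = Bot") (auto simp: tdom_def less_eq_trit_def)
    qed
    then show "e \<in> J"
      using j eK assms(3) unfolding ideals_def down_closed_in_def by blast
  qed
qed

definition D_S :: "'a topology \<Rightarrow> (nat \<Rightarrow> bool \<Rightarrow> 'a set) \<Rightarrow> tseq set" where
  "D_S X S = ideal_completion (K_S X S)"

definition Dhat_S :: "'a topology \<Rightarrow> (nat \<Rightarrow> bool \<Rightarrow> 'a set) \<Rightarrow> tseq set" where
  "Dhat_S X S = ideal_completion (Khat_S X S)"

end

theory Submission
  imports Defs
begin

text \<open>
  Write \<open>x~\<close> for \<open>phi X S x\<close>. Both \<open>K_S X S\<close> and \<open>Khat_S X S\<close> are sets \<open>K\<close> of finite sequences closed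
  under truncation, and \<open>K_S X S \<subseteq> K \<subseteq> Khat_S X S\<close>. Everything below is proved for any such \<open>K\<close>, so
  the two choices of the domain need no separate treatment.

  For \<open>K\<close> closed under truncation, the ideal completion \<open>D\<close> is the set of sequences all of whose
  truncations lie in \<open>K\<close> (\<open>D_iff\<close>). Directed suprema in \<open>D\<close> agree with those among all sequences,
  the compact elements are those of \<open>K\<close>, and so the non-compact elements are the members of \<open>D\<close> with
  infinitely many digits.

  On the side of \<open>X\<close>, properness and regularity say that the sets \<open>Sclosed X S (trunc x~ m)\<close>, the
  closures of the basic open sets \<open>Sopen X S (trunc x~ m)\<close>, shrink to \<open>x\<close> (\<open>Sclosed_trunc_base\<close>).
  With the Hausdorff property this gives \<open>Sclosed X S p = {x}\<close> whenever \<open>x~ \<le> p\<close>, and it makes \<open>rho\<close>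
  continuous; its continuous right inverse is \<open>phi\<close>. Both \<open>rho\<close> and its restriction to
  \<open>Xtilde X S\<close>, the inverse of \<open>phi\<close>, are therefore retractions, hence quotient maps. Density is
  the statement that \<open>Sopen X S e\<close> is nonempty for every \<open>e \<in> Khat_S X S\<close>, which follows from
  properness since its closure \<open>Sclosed X S e\<close> is.

  The order-theoretic claims rest on \<open>noncompact_approx\<close>: if \<open>q \<in> D\<close> has infinitely many digits, then
  for every \<open>n\<close> there is a point \<open>y\<close> whose digits below \<open>n\<close> are all digits of \<open>q\<close>. If moreover
  \<open>q \<le> p\<close> and \<open>x~ \<le> p\<close>, then these \<open>y\<close> eventually lie in \<open>Sclosed X S (trunc x~ m)\<close>, so they converge
  to \<open>x\<close>. Thus each digit of \<open>x~\<close> is eventually a digit of \<open>y~\<close> and hence a digit of \<open>q\<close>, that is,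
  \<open>x~ \<le> q\<close> (\<open>noncompact_below_above_phi\<close>). If \<open>X\<close> is compact, the approximating points of any
  non-compact \<open>q\<close> accumulate at some \<open>y\<close>, and then \<open>y~ \<le> q\<close>.
\<close>


section \<open>Truncations\<close>

lemma le_tseq_iff: "p \<le> q \<longleftrightarrow> (\<forall>k a. p k = Dig a \<longrightarrow> q k = Dig a)" for p q :: tseq
  unfolding le_fun_def less_eq_trit_def by (metis trit.exhaust trit.distinct(1))

lemma trunc_le: "trunc p m \<le> p"
  by (auto simp: le_tseq_iff trunc_def split: if_splits)

lemma trunc_mono: "p \<le> q \<Longrightarrow> trunc p m \<le> trunc q m"
  by (auto simp: le_tseq_iff trunc_def split: if_splits)

lemma trunc_trunc: "trunc (trunc p m) n = trunc p (min m n)"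
  by (auto simp: trunc_def)

lemma trunc_le_trunc: "m \<le> n \<Longrightarrow> trunc p m \<le> trunc p n"
  by (auto simp: le_tseq_iff trunc_def split: if_splits)

lemma trunc_in_tfin: "trunc p m \<in> tfin"
proof -
  have "tdom (trunc p m) \<subseteq> {..<m}"
    by (auto simp: tdom_def trunc_def)
  then show ?thesis
    using finite_subset by (auto simp: tfin_def)
qed

lemma tfin_eq_trunc:
  assumes "e \<in> tfin"
  obtains m where "trunc e m = e"
proof -
  obtain m where "\<forall>k\<in>tdom e. k < m"
    using assms finite_nat_set_iff_bounded by (auto simp: tfin_def)
  then have "trunc e m = e"
    by (force simp: trunc_def tdom_def fun_eq_iff)
  then show ?thesis ..
qed

lemma isLub_truncs: "isLub UNIV (range (trunc p)) p"
  unfolding isLub_UNIV_iff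
proof (intro conjI allI impI ballI)
  fix q assume q: "\<forall>e\<in>range (trunc p). e \<le> q"
  have "p k \<le> q k" for k
    using q le_funD[of "trunc p (Suc k)" q k] by (auto simp: trunc_def)
  then show "p \<le> q"
    by (simp add: le_fun_def)
qed (auto simp: trunc_le)

lemma tdom_mono: "p \<le> q \<Longrightarrow> tdom p \<subseteq> tdom q"
  unfolding le_fun_def tdom_def less_eq_trit_def by auto

lemma countable_tfin: "countable tfin"
proof -
  have "tfin \<subseteq> (\<lambda>xs k. if k < length xs then xs ! k else Bot) ` (lists {Bot, Dig False, Dig True})"
  proof
    fix e assume "e \<in> tfin"
    then obtain m where m: "trunc e m = e"
      by (rule tfin_eq_trunc)
    have "UNIV = {Bot, Dig False, Dig True}"
      by (auto, metis (full_types) trit.exhaust)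
    then have "map e [0..<m] \<in> lists {Bot, Dig False, Dig True}"
      by auto
    moreover have "e = (\<lambda>k. if k < length (map e [0..<m]) then map e [0..<m] ! k else Bot)"
      by (subst m[symmetric]) (auto simp: trunc_def fun_eq_iff)
    ultimately show "e \<in> (\<lambda>xs k. if k < length xs then xs ! k else Bot) ` (lists {Bot, Dig False, Dig True})"
      by (rule rev_image_eqI)
  qed
  moreover have "countable (lists {Bot, Dig False, Dig True})"
    by (rule countable_lists) auto
  ultimately show ?thesis
    by (rule countable_subset[OF _ countable_image])
qed

text \<open>
  Finite sequences are compact in the poset of all sequences. The set \<open>P\<close> plays no role beyond
  containing \<open>A\<close>.
\<close>

lemma tfin_below_directed_sup:
  assumes A: "directed_in P A" and s: "isLub UNIV A s" and e: "e \<in> tfin" "e \<le> s"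
  shows "\<exists>a\<in>A. e \<le> a"
proof -
  have hit: "\<exists>a\<in>A. s k \<le> a k" for k
  proof (rule ccontr)
    assume n: "\<not> ?thesis"
    have "a \<le> s(k := Bot)" if "a \<in> A" for a
    proof (rule le_funI)
      have "a i \<le> s i" for i
        using s that unfolding isLub_UNIV_iff by (auto dest: le_funD)
      then show "a i \<le> (s(k := Bot)) i" for i
        using n that by (cases "i = k") (simp_all add: less_eq_trit_def, metis)
    qed
    then have "s \<le> s(k := Bot)"
      using s unfolding isLub_UNIV_iff by blast
    then have "s k = Bot"
      by (metis fun_upd_same le_funD less_eq_trit_def)
    then show False
      using n A by (auto simp: directed_in_def less_eq_trit_def)
  qed
  have "\<exists>a\<in>A. trunc s m \<le> a" for m
  proof (induction m)
    case 0
    then show ?case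
      using A by (auto simp: directed_in_def trunc_def le_fun_def less_eq_trit_def)
  next
    case (Suc m)
    then obtain a b where "a \<in> A" "trunc s m \<le> a" "b \<in> A" "s m \<le> b m"
      using hit by blast
    moreover from this obtain c where "c \<in> A" "a \<le> c" "b \<le> c"
      using A unfolding directed_in_def by metis
    ultimately have c: "c \<in> A" "trunc s m \<le> c" "s m \<le> c m"
      using order_trans[of _ a c] order_trans[OF _ le_funD[of b c m]] by blast+
    have "trunc s (Suc m) \<le> c"
    proof (rule le_funI)
      show "trunc s (Suc m) k \<le> c k" for k
        using c(3) le_funD[OF c(2), of k]
        by (auto simp: trunc_def less_Suc_eq less_eq_trit_def split: if_splits)
    qed
    then show ?case
      using c(1) by blast
  qed
  moreover obtain m where "trunc e m = e"
    using e(1) by (rule tfin_eq_trunc)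
  ultimately show ?thesis
    using trunc_mono[OF e(2), of m] by (metis order_trans)
qed

lemma directed_has_sup:
  assumes "directed_in P A"
  shows "\<exists>s::tseq. isLub UNIV A s"
proof -
  let ?I = "{x. \<exists>a\<in>A. x \<le> a}"
  have "?I \<in> ideals UNIV"
    unfolding ideals_def
  proof (intro CollectI conjI)
    show "directed_in UNIV ?I"
      unfolding directed_in_def
    proof (intro conjI ballI)
      show "?I \<noteq> {}"
        using assms unfolding directed_in_def by blast
      fix x y assume "x \<in> ?I" "y \<in> ?I"
      then obtain a b where ab: "a \<in> A" "x \<le> a" "b \<in> A" "y \<le> b"
        by blast
      then obtain c where "c \<in> A" "a \<le> c" "b \<le> c"
        using assms unfolding directed_in_def by metis
      then have "c \<in> ?I" "x \<le> c" "y \<le> c"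
        using ab order_trans by blast+
      then show "\<exists>c\<in>?I. x \<le> c \<and> y \<le> c"
        by blast
    qed auto
    show "down_closed_in UNIV ?I"
      unfolding down_closed_in_def by (blast intro: order_trans)
  qed
  then obtain s where "isLub UNIV ?I s"
    using ideal_has_sup by blast
  then have "isLub UNIV A s"
    unfolding isLub_UNIV_iff by (blast intro: order_trans)
  then show ?thesis
    by blast
qed


section \<open>The ideal completion of a prefix-closed set of finite sequences\<close>

text \<open>A nonempty set of finite sequences that contains all truncations of its members.\<close>

locale prefix_closed =
  fixes K :: "tseq set"
  assumes K_tfin: "K \<subseteq> tfin" and K_nonempty: "K \<noteq> {}"
    and trunc_K: "e \<in> K \<Longrightarrow> trunc e m \<in> K"
begin

abbreviation D :: "tseq set" where
  "D \<equiv> ideal_completion K"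

text \<open>
  Every truncation of the supremum \<open>p\<close> of an ideal lies below some member \<open>e \<le> p\<close> of the ideal, and so
  is a truncation of \<open>e\<close>. Conversely, the members of \<open>K\<close> below some truncation of \<open>p\<close> form an ideal
  with supremum \<open>p\<close>.
\<close>

lemma D_iff: "p \<in> D \<longleftrightarrow> (\<forall>m. trunc p m \<in> K)"
proof
  assume "p \<in> D"
  then obtain I where I: "directed_in K I" "isLub UNIV I p"
    unfolding ideal_completion_def ideals_def by blast
  show "\<forall>m. trunc p m \<in> K"
  proof
    fix m
    obtain e where e: "e \<in> I" "trunc p m \<le> e"
      using tfin_below_directed_sup[OF I trunc_in_tfin trunc_le] by blast
    have "e \<le> p"
      using e I unfolding isLub_UNIV_iff by blast
    then have "trunc p m = trunc e m"
      using trunc_mono[OF e(2), of m] trunc_mono[of e p m]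
      by (auto simp: trunc_trunc intro: antisym)
    then show "trunc p m \<in> K"
      using e(1) I(1) trunc_K by (auto simp: directed_in_def)
  qed
next
  assume p: "\<forall>m. trunc p m \<in> K"
  let ?I = "{e\<in>K. \<exists>m. e \<le> trunc p m}"
  have "directed_in K ?I"
    unfolding directed_in_def
  proof (intro conjI ballI)
    show "?I \<noteq> {}"
      using p by blast
    fix a b assume "a \<in> ?I" "b \<in> ?I"
    then obtain m n where mn: "a \<le> trunc p m" "b \<le> trunc p n"
      by blast
    have "a \<le> trunc p (max m n)" "b \<le> trunc p (max m n)"
      by (rule order_trans[OF mn(1) trunc_le_trunc] order_trans[OF mn(2) trunc_le_trunc]; simp)+
    then show "\<exists>c\<in>?I. a \<le> c \<and> b \<le> c"
      using p by blast
  qed auto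
  moreover have "down_closed_in K ?I"
    unfolding down_closed_in_def by (blast intro: order_trans)
  moreover have "isLub UNIV ?I p"
    unfolding isLub_UNIV_iff
  proof (intro conjI allI impI ballI)
    show "e \<le> p" if "e \<in> ?I" for e
      using that trunc_le order_trans by blast
    show "p \<le> q" if "\<forall>e\<in>?I. e \<le> q" for q
      using isLub_truncs[of p] that p unfolding isLub_UNIV_iff by blast
  qed
  ultimately show "p \<in> D"
    unfolding ideal_completion_def ideals_def by blast
qed

lemma K_subset_D: "K \<subseteq> D"
  by (simp add: subset_iff D_iff trunc_K)

lemma directed_sup_in_D:
  assumes A: "directed_in D A" and s: "isLub UNIV A s"
  shows "s \<in> D"
  unfolding D_iff
proof
  fix m
  obtain a where a: "a \<in> A" "trunc s m \<le> a"
    using tfin_below_directed_sup[OF A s trunc_in_tfin trunc_le] by blast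
  have "a \<le> s"
    using a s unfolding isLub_UNIV_iff by blast
  then have "trunc s m = trunc a m"
    using trunc_mono[OF a(2), of m] trunc_mono[of a s m]
    by (auto simp: trunc_trunc intro: antisym)
  moreover have "a \<in> D"
    using a A by (auto simp: directed_in_def)
  ultimately show "trunc s m \<in> K"
    by (simp add: D_iff)
qed

lemma isLub_D_iff:
  assumes A: "directed_in D A"
  shows "isLub D A s \<longleftrightarrow> isLub UNIV A s"
proof -
  have up: "isLub D A t" if "isLub UNIV A t" for t
    using that directed_sup_in_D[OF A that]
    by (auto simp: isLub_def leastP_def isUb_def setge_def)
  obtain t where t: "isLub UNIV A t"
    using directed_has_sup[OF A] by blast
  show ?thesis
    using up[OF t] up t by (metis isLub_unique antisym isLub_le_isUb isLub_isUb)
qed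

lemma tfin_below_sup_in_D:
  assumes "directed_in D A" "isLub D A s" "e \<in> tfin" "e \<le> s"
  shows "\<exists>a\<in>A. e \<le> a"
  using tfin_below_directed_sup[OF assms(1) _ assms(3,4)] assms(2) isLub_D_iff[OF assms(1)]
  by simp

lemma directed_truncs:
  assumes "p \<in> D"
  shows "directed_in D (range (trunc p))"
  unfolding directed_in_def
proof (intro conjI ballI)
  show "range (trunc p) \<subseteq> D"
    using assms K_subset_D D_iff by blast
  show "\<exists>c\<in>range (trunc p). a \<le> c \<and> b \<le> c" if ab: "a \<in> range (trunc p)" "b \<in> range (trunc p)" for a b
  proof -
    obtain m n where "a = trunc p m" "b = trunc p n"
      using ab by blast
    then have "a \<le> trunc p (max m n)" "b \<le> trunc p (max m n)"
      by (auto intro: trunc_le_trunc)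
    then show ?thesis
      by blast
  qed
qed auto

lemma compact_elems_D: "compact_elems D = K"
proof
  show "compact_elems D \<subseteq> K"
  proof
    fix c assume c: "c \<in> compact_elems D"
    then have cD: "c \<in> D"
      by (simp add: compact_elems_def)
    have "isLub D (range (trunc c)) c"
      using isLub_truncs directed_truncs[OF cD] by (simp add: isLub_D_iff)
    then obtain m where "c \<le> trunc c m"
      using c directed_truncs[OF cD] unfolding compact_elems_def by blast
    then have "trunc c m = c"
      by (simp add: trunc_le antisym)
    then show "c \<in> K"
      using cD by (metis D_iff)
  qed
  show "K \<subseteq> compact_elems D"
    using K_tfin K_subset_D tfin_below_sup_in_D unfolding compact_elems_def by blast
qed

lemma noncompact_elems_D: "noncompact_elems D = {p \<in> D. infinite (tdom p)}"
proof -
  have "p \<in> K" if "p \<in> D" "finite (tdom p)" for p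
    using that tfin_eq_trunc[of p] by (metis D_iff mem_Collect_eq tfin_def)
  then show ?thesis
    using K_tfin by (auto simp: noncompact_elems_def compact_elems_D tfin_def)
qed

lemma omega_domain_D: "omega_domain D"
  unfolding omega_domain_def
proof (intro conjI)
  show "dcpo D"
    unfolding dcpo_def using directed_has_sup isLub_D_iff by blast
  show "pointed D"
    unfolding pointed_def
  proof (intro bexI ballI)
    show "(\<lambda>_. Bot) \<le> x" for x :: tseq
      by (simp add: le_tseq_iff)
    obtain e where "e \<in> K"
      using K_nonempty by blast
    then have "trunc e 0 \<in> K"
      by (rule trunc_K)
    then show "(\<lambda>_. Bot) \<in> D"
      using K_subset_D by (auto simp: trunc_def)
  qed
  show "omega_algebraic D"
    unfolding omega_algebraic_def compact_elems_D
  proof (intro conjI ballI)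
    show "countable K"
      using countable_subset[OF K_tfin countable_tfin] .
    fix x assume x: "x \<in> D"
    let ?C = "{c \<in> K. c \<le> x}"
    have tr: "trunc x m \<in> ?C" for m
      using x by (simp add: D_iff trunc_le)
    show dir: "directed_in D ?C"
      unfolding directed_in_def
    proof (intro conjI ballI)
      show "?C \<subseteq> D"
        using K_subset_D by blast
      show "?C \<noteq> {}"
        using tr by blast
      fix a b assume ab: "a \<in> ?C" "b \<in> ?C"
      then have "a \<in> tfin" "b \<in> tfin" "a \<le> x" "b \<le> x"
        using K_tfin by auto
      then obtain m n where "a \<le> trunc x m" "b \<le> trunc x n"
        using tfin_eq_trunc trunc_mono by metis
      then have "a \<le> trunc x (max m n)" "b \<le> trunc x (max m n)"
        by (meson trunc_le_trunc max.cobounded1 max.cobounded2 order_trans)+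
      then show "\<exists>c\<in>?C. a \<le> c \<and> b \<le> c"
        using tr by blast
    qed
    have "isLub UNIV ?C x"
      using isLub_truncs[of x] tr unfolding isLub_UNIV_iff by blast
    then show "isLub D ?C x"
      using dir by (simp add: isLub_D_iff)
  qed
qed

lemma scott_open_contains_trunc:
  assumes "scott_open D U" "p \<in> U"
  shows "\<exists>m. trunc p m \<in> U"
proof -
  have p: "p \<in> D"
    using assms by (auto simp: scott_open_def)
  have "isLub D (range (trunc p)) p"
    using isLub_truncs directed_truncs[OF p] by (simp add: isLub_D_iff)
  then show ?thesis
    using assms directed_truncs[OF p] unfolding scott_open_def by blast
qed

lemma scott_open_above:
  assumes "e \<in> tfin"
  shows "scott_open D {p \<in> D. e \<le> p}"
  unfolding scott_open_def
proof (intro conjI allI impI ballI)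
  fix A s assume A: "directed_in D A" "isLub D A s" and "s \<in> {p \<in> D. e \<le> p}"
  then have "\<exists>a\<in>A. e \<le> a"
    using tfin_below_sup_in_D[OF A assms] by blast
  then show "A \<inter> {p \<in> D. e \<le> p} \<noteq> {}"
    using A(1) by (auto simp: directed_in_def)
next
  fix x y assume "x \<in> {p \<in> D. e \<le> p}" "y \<in> D" "x \<le> y"
  then show "y \<in> {p \<in> D. e \<le> p}"
    using order_trans[of e x y] by blast
qed blast

end


section \<open>Proper dyadic subbases of regular Hausdorff spaces\<close>

locale proper_dyadic_space =
  fixes X :: "'a topology" and S :: "nat \<Rightarrow> bool \<Rightarrow> 'a set"
  assumes hausdorff: "Hausdorff_space X" and regular: "regular_space X"
    and proper: "proper_dyadic_subbase X S"
begin

lemma openin_S: "openin X (S n a)"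
  using proper by (auto simp: proper_dyadic_subbase_def dyadic_subbase_def regular_open_in_def)

lemma S_subset: "S n a \<subseteq> topspace X"
  by (simp add: openin_S openin_subset)

text \<open>
  Each of \<open>S n False\<close> and \<open>S n True\<close> is the exterior of the other. That \<open>S n False\<close> is the exterior of
  \<open>S n True\<close> holds because it is regular open.
\<close>

lemma closure_of_S: "X closure_of S n a = topspace X - S n (\<not> a)"
proof -
  have T: "S n True = topspace X - X closure_of S n False"
    and F: "X interior_of (X closure_of S n False) = S n False"
    using proper by (auto simp: proper_dyadic_subbase_def dyadic_subbase_def regular_open_in_def)
  have F': "X closure_of S n False = topspace X - S n True"
    using T closure_of_subset_topspace[of X "S n False"] by blast
  have "S n False = topspace X - X closure_of S n True"
    using F unfolding F' by (simp add: interior_of_complement)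
  then have "X closure_of S n True = topspace X - S n False"
    using closure_of_subset_topspace[of X "S n True"] by blast
  with F' show ?thesis
    by (cases a) auto
qed

lemma S_disjoint: "x \<in> S n a \<Longrightarrow> x \<in> S n b \<Longrightarrow> a = b"
  using closure_of_S[of n a] closure_of_subset[OF S_subset[of n a]] by (cases a; cases b) auto

lemma phi_eq_Dig_iff:
  assumes x: "x \<in> topspace X"
  shows "phi X S x n = Dig a \<longleftrightarrow> x \<in> S n a"
proof -
  have "\<exists>!c. x \<in> cell X S n c"
  proof (cases "x \<in> S n False \<union> S n True")
    case True
    then obtain b where b: "x \<in> S n b"
      by blast
    show ?thesis
    proof (rule ex1I[of _ "Dig b"])
      show "x \<in> cell X S n (Dig b)"
        using b by (simp add: cell_def)
      show "c = Dig b" if "x \<in> cell X S n c" for c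
        using that True b S_disjoint by (cases c) (auto simp: cell_def)
    qed
  next
    case False
    show ?thesis
    proof (rule ex1I[of _ Bot])
      show "x \<in> cell X S n Bot"
        using x False by (simp add: cell_def)
      show "c = Bot" if c: "x \<in> cell X S n c" for c
      proof (cases c)
        case (Dig d)
        then show ?thesis
          using c False by (cases d) (auto simp: cell_def)
      qed simp
    qed
  qed
  then have "phi X S x n = c \<longleftrightarrow> x \<in> cell X S n c" for c
    unfolding phi_def by (metis (mono_tags, lifting) theI')
  then show ?thesis
    by (simp add: cell_def)
qed

lemma in_Sopen_iff:
  assumes x: "x \<in> topspace X"
  shows "x \<in> Sopen X S p \<longleftrightarrow> p \<le> phi X S x"
proof -
  have "p k \<noteq> Bot \<longleftrightarrow> (\<exists>a. p k = Dig a)" for k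
    by (cases "p k") auto
  then show ?thesis
    using x by (auto simp: Sopen_def le_tseq_iff tdom_def phi_eq_Dig_iff cell_def)
qed

text \<open>
  By \<open>closure_of_S\<close>, a point lies in \<open>Sclosed X S p\<close> iff its sequence is compatible with \<open>p\<close>: the two
  never have opposite digits at the same index.
\<close>

lemma in_Sclosed_iff:
  assumes x: "x \<in> topspace X"
  shows "x \<in> Sclosed X S p \<longleftrightarrow> (\<forall>k a. p k = Dig a \<longrightarrow> x \<notin> S k (\<not> a))"
proof -
  have "p k \<noteq> Bot \<longleftrightarrow> (\<exists>a. p k = Dig a)" for k
    by (cases "p k") auto
  then show ?thesis
    using x by (auto simp: Sclosed_def tdom_def cell_def closure_of_S)
qed

lemma Sclosed_subset: "Sclosed X S p \<subseteq> topspace X"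
  by (auto simp: Sclosed_def)

lemma Sclosed_antimono:
  assumes "p \<le> q"
  shows "Sclosed X S q \<subseteq> Sclosed X S p"
proof
  fix x assume x: "x \<in> Sclosed X S q"
  then have "x \<in> topspace X"
    using Sclosed_subset by blast
  then show "x \<in> Sclosed X S p"
    using x assms by (simp add: in_Sclosed_iff le_tseq_iff)
qed

lemma above_phi_in_Sclosed:
  assumes "x \<in> topspace X" "phi X S x \<le> p"
  shows "x \<in> Sclosed X S p"
proof -
  have "x \<notin> S k (\<not> a)" if "p k = Dig a" for k a
    using assms that by (auto simp: le_tseq_iff phi_eq_Dig_iff)
  then show ?thesis
    using assms(1) by (simp add: in_Sclosed_iff)
qed

lemma openin_Sopen_trunc: "openin X (Sopen X S (trunc p m))"
proof -
  have "finite (tdom (trunc p m))"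
    using trunc_in_tfin[of p m] by (simp add: tfin_def)
  moreover have "openin X (cell X S k (trunc p m k))" if "k \<in> tdom (trunc p m)" for k
    using that openin_S by (cases "trunc p m k") (auto simp: tdom_def cell_def)
  ultimately have "openin X (\<Inter>(insert (topspace X) ((\<lambda>k. cell X S k (trunc p m k)) ` tdom (trunc p m))))"
    by (intro openin_Inter) auto
  then show ?thesis
    by (simp add: Sopen_def)
qed

lemma Sopen_trunc_base:
  assumes U: "openin X U" and x: "x \<in> U"
  obtains m where "Sopen X S (trunc (phi X S x) m) \<subseteq> U"
proof -
  have xX: "x \<in> topspace X"
    using U x openin_subset by blast
  have "(arbitrary union_of
      (finite intersection_of (\<lambda>U. U \<in> {S n a |n a. True}) relative_to topspace X)) U"
    using proper U by (simp add: proper_dyadic_subbase_def dyadic_subbase_def subbase_of_def)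
  then obtain F where F: "finite F" "F \<subseteq> {S n a |n a. True}" "x \<in> \<Inter>F" "topspace X \<inter> \<Inter>F \<subseteq> U"
    using x unfolding arbitrary_union_of_alt relative_to_def intersection_of_def by fastforce
  have "\<forall>G\<in>F. \<exists>n. \<exists>a. G = S n a"
    using F(2) by blast
  then obtain f where f: "\<forall>G\<in>F. \<exists>a. G = S (f G) a"
    by (rule bchoice[THEN exE])
  obtain m where m: "\<forall>k\<in>f ` F. k < m"
    using F(1) finite_nat_set_iff_bounded[of "f ` F"] by blast
  have "Sopen X S (trunc (phi X S x) m) \<subseteq> U"
  proof
    fix y assume y: "y \<in> Sopen X S (trunc (phi X S x) m)"
    then have yX: "y \<in> topspace X"
      by (simp add: Sopen_def)
    have le: "trunc (phi X S x) m \<le> phi X S y"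
      using y in_Sopen_iff[OF yX] by blast
    have "y \<in> G" if G: "G \<in> F" for G
    proof -
      obtain a where a: "G = S (f G) a"
        using f G by blast
      have "f G < m"
        using m G by blast
      moreover have "x \<in> S (f G) a"
        using F(3) G a by blast
      ultimately have "trunc (phi X S x) m (f G) = Dig a"
        by (simp add: trunc_def phi_eq_Dig_iff xX)
      then have "phi X S y (f G) = Dig a"
        using le by (simp add: le_tseq_iff)
      then show ?thesis
        using a by (simp add: phi_eq_Dig_iff yX)
    qed
    then show "y \<in> U"
      using F(4) yX by blast
  qed
  then show ?thesis ..
qed

text \<open>
  Regularity allows the basic neighbourhood \<open>Sopen X S (trunc (phi X S x) m)\<close> to be chosen with its
  closure inside \<open>U\<close>; properness identifies that closure.
\<close>

lemma Sclosed_trunc_base: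
  assumes U: "openin X U" and x: "x \<in> U"
  obtains m where "Sclosed X S (trunc (phi X S x) m) \<subseteq> U"
proof -
  have "neighbourhood_base_of (closedin X) X"
    by (simp add: neighbourhood_base_of_closedin regular)
  then have "\<exists>V C. openin X V \<and> closedin X C \<and> x \<in> V \<and> V \<subseteq> C \<and> C \<subseteq> U"
    unfolding neighbourhood_base_of using U x by simp
  then obtain V C where VC: "openin X V" "closedin X C" "x \<in> V" "V \<subseteq> C" "C \<subseteq> U"
    by (elim exE conjE)
  obtain m where "Sopen X S (trunc (phi X S x) m) \<subseteq> V"
    using Sopen_trunc_base VC by metis
  then have "X closure_of Sopen X S (trunc (phi X S x) m) \<subseteq> C"
    using VC by (meson closure_of_minimal order_trans)
  moreover have "X closure_of Sopen X S (trunc (phi X S x) m) = Sclosed X S (trunc (phi X S x) m)"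
    using proper trunc_in_tfin by (auto simp: proper_dyadic_subbase_def)
  ultimately show ?thesis
    using VC that by blast
qed

lemma Sclosed_above_phi:
  assumes x: "x \<in> topspace X" and p: "phi X S x \<le> p"
  shows "Sclosed X S p = {x}"
proof -
  have "y = x" if y: "y \<in> Sclosed X S p" for y
  proof (rule ccontr)
    assume "y \<noteq> x"
    then obtain U V where UV: "openin X U" "openin X V" "x \<in> U" "y \<in> V" "disjnt U V"
      using hausdorff x y Sclosed_subset unfolding Hausdorff_space_def by (metis subsetD)
    obtain m where m: "Sclosed X S (trunc (phi X S x) m) \<subseteq> U"
      using Sclosed_trunc_base UV by metis
    have "trunc (phi X S x) m \<le> p"
      using p trunc_le order_trans by blast
    then have "y \<in> U"
      using m y Sclosed_antimono by blast
    then show False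
      using UV by (auto simp: disjnt_def)
  qed
  then show ?thesis
    using above_phi_in_Sclosed[OF x p] by blast
qed

lemma rho_eq:
  assumes "x \<in> topspace X" "phi X S x \<le> p"
  shows "rho X S p = x"
  using Sclosed_above_phi[OF assms] by (simp add: rho_def)

lemma phi_le_imp_eq:
  assumes "x \<in> topspace X" "y \<in> topspace X" "phi X S x \<le> phi X S y"
  shows "x = y"
  using rho_eq[of x "phi X S y"] rho_eq[of y "phi X S y"] assms by simp

lemma inj_on_phi: "inj_on (phi X S) (topspace X)"
  by (rule inj_onI) (simp add: phi_le_imp_eq)

text \<open>
  If \<open>phi X S x\<close> had finite domain, then \<open>x\<close> would be an isolated point; but an isolated point is on
  the boundary of no \<open>S k False\<close>, so its sequence has a digit everywhere.
\<close>

lemma infinite_tdom_phi: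
  assumes x: "x \<in> topspace X"
  shows "infinite (tdom (phi X S x))"
proof
  assume fin: "finite (tdom (phi X S x))"
  then have "phi X S x \<in> tfin"
    by (simp add: tfin_def)
  then obtain m where m: "trunc (phi X S x) m = phi X S x"
    by (rule tfin_eq_trunc)
  have "Sopen X S (phi X S x) \<subseteq> {x}"
  proof
    fix y assume y: "y \<in> Sopen X S (phi X S x)"
    then have yX: "y \<in> topspace X"
      by (simp add: Sopen_def)
    then show "y \<in> {x}"
      using y x in_Sopen_iff phi_le_imp_eq by blast
  qed
  moreover have "x \<in> Sopen X S (phi X S x)"
    using x in_Sopen_iff by blast
  ultimately have "openin X {x}"
    using openin_Sopen_trunc[of "phi X S x" m] m by (metis subset_singletonD empty_iff)
  moreover obtain k where k: "k \<notin> tdom (phi X S x)"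
    using fin ex_new_if_finite infinite_UNIV_nat by blast
  have "x \<notin> S k a" for a
    using k phi_eq_Dig_iff[OF x, of k a] by (auto simp: tdom_def)
  then have "x \<in> X closure_of S k False" "x \<notin> S k False"
    using x closure_of_S by blast+
  ultimately show False
    unfolding in_closure_of by blast
qed

end


section \<open>The domains between the two ideal completions\<close>

text \<open>
  The set \<open>K\<close> of finite sequences may be any prefix-closed set between \<open>K_S X S\<close> and \<open>Khat_S X S\<close>.
\<close>

locale dyadic_domain = proper_dyadic_space X S + prefix_closed K
  for X :: "'a topology" and S and K +
  assumes K_S_subset: "K_S X S \<subseteq> K" and K_subset_Khat: "K \<subseteq> Khat_S X S"
begin

text \<open>The domain of the retraction: the upward closure of \<open>Xtilde X S\<close> in \<open>D\<close>.\<close>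

abbreviation R :: "tseq set" where
  "R \<equiv> up_closure_in D (Xtilde X S)"

lemma phi_in_D:
  assumes "x \<in> topspace X"
  shows "phi X S x \<in> D"
  using assms K_S_subset unfolding D_iff K_S_def Xtilde_def by blast

lemma Xtilde_subset_R: "Xtilde X S \<subseteq> R"
  using phi_in_D by (auto simp: Xtilde_def up_closure_in_def)

lemma R_cases:
  assumes "p \<in> R"
  obtains x where "x \<in> topspace X" "phi X S x \<le> p" "p \<in> D"
  using assms by (auto simp: Xtilde_def up_closure_in_def)

lemma R_subset_noncompact: "R \<subseteq> noncompact_elems D"
proof
  fix p assume "p \<in> R"
  then obtain x where "x \<in> topspace X" "phi X S x \<le> p" "p \<in> D"
    by (rule R_cases)
  then show "p \<in> noncompact_elems D"
    using infinite_tdom_phi[of x] finite_subset[OF tdom_mono] by (auto simp: noncompact_elems_D)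
qed

text \<open>
  A member of \<open>Khat_S X S\<close> is a truncation \<open>trunc r l\<close> of some \<open>r \<ge> phi X S y\<close>, but its missing digits
  say something about \<open>r\<close> only at indices below \<open>l\<close>, and \<open>l\<close> is not determined by the member. A digit
  of \<open>q\<close> at an index \<open>j \<ge> n\<close> forces \<open>l > n\<close> for \<open>trunc q (Suc j)\<close>. Such a \<open>j\<close> exists because \<open>q\<close> has
  infinitely many digits.
\<close>

lemma noncompact_approx:
  assumes q: "q \<in> noncompact_elems D"
  obtains y where "y \<in> topspace X" "trunc (phi X S y) n \<le> q"
proof -
  have qD: "q \<in> D" and inf: "infinite (tdom q)"
    using q by (auto simp: noncompact_elems_D)
  obtain j where j: "n \<le> j" "q j \<noteq> Bot"
    using inf unfolding infinite_nat_iff_unbounded_le tdom_def by blast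
  have "trunc q (Suc j) \<in> Khat_S X S"
    using qD K_subset_Khat by (auto simp: D_iff)
  then obtain r l y where y: "y \<in> topspace X" "phi X S y \<le> r" "trunc q (Suc j) = trunc r l"
    by (auto simp: Khat_S_def up_closure_in_def Xtilde_def)
  have "trunc r l j \<noteq> Bot"
    unfolding y(3)[symmetric] using j(2) by (simp add: trunc_def)
  then have "n \<le> l"
    using j(1) by (auto simp: trunc_def split: if_splits)
  then have "trunc (phi X S y) n \<le> trunc r l"
    using trunc_mono[OF y(2), of n] trunc_le_trunc[of n l r] by simp
  then have "trunc (phi X S y) n \<le> q"
    using trunc_le[of q "Suc j"] unfolding y(3)[symmetric] by (rule order_trans)
  then show ?thesis
    using that y(1) by blast
qed

text \<open>The key step; the approximating points of \<open>q\<close> converge to \<open>x\<close>.\<close>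

lemma noncompact_below_above_phi:
  assumes x: "x \<in> topspace X" "phi X S x \<le> p" and q: "q \<in> noncompact_elems D" "q \<le> p"
  shows "phi X S x \<le> q"
  unfolding le_tseq_iff
proof (intro allI impI)
  fix k a assume "phi X S x k = Dig a"
  then have "x \<in> S k a"
    by (simp add: x phi_eq_Dig_iff)
  then obtain m where m: "Sclosed X S (trunc (phi X S x) m) \<subseteq> S k a"
    using Sclosed_trunc_base openin_S by metis
  obtain y where y: "y \<in> topspace X" "trunc (phi X S y) (max m (Suc k)) \<le> q"
    using noncompact_approx[OF q(1)] by blast
  have yq: "phi X S y i = Dig b \<Longrightarrow> i < max m (Suc k) \<Longrightarrow> q i = Dig b" for i b
    using y(2) by (auto simp: le_tseq_iff trunc_def)
  \<comment> \<open>\<open>y\<close> is close to \<open>x\<close>: below \<open>m\<close>, all digits of both \<open>y\<close> and \<open>x\<close> are digits of \<open>p\<close>.\<close>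
  have "y \<notin> S i (\<not> b)" if "trunc (phi X S x) m i = Dig b" for i b
  proof
    assume "y \<in> S i (\<not> b)"
    moreover have "i < m" "phi X S x i = Dig b"
      using that by (auto simp: trunc_def split: if_splits)
    ultimately have "q i = Dig (\<not> b)" "p i = Dig b"
      using yq[of i "\<not> b"] x(2) by (auto simp: phi_eq_Dig_iff y(1) le_tseq_iff)
    then show False
      using q(2) by (auto simp: le_tseq_iff)
  qed
  then have "y \<in> S k a"
    using m y(1) in_Sclosed_iff by blast
  then show "q k = Dig a"
    using yq[of k a] by (simp add: phi_eq_Dig_iff y(1))
qed

lemma R_down_closed:
  assumes "p \<in> R" "q \<in> noncompact_elems D" "q \<le> p"
  shows "q \<in> R"
proof -
  obtain x where "x \<in> topspace X" "phi X S x \<le> p"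
    using assms(1) by (rule R_cases)
  then have "phi X S x \<le> q" "phi X S x \<in> Xtilde X S"
    using assms noncompact_below_above_phi by (auto simp: Xtilde_def)
  then show ?thesis
    using assms(2) by (auto simp: up_closure_in_def noncompact_elems_def)
qed

lemma Xtilde_minimal: "Xtilde X S \<subseteq> minimals (noncompact_elems D)"
proof
  fix p assume p: "p \<in> Xtilde X S"
  then obtain x where x: "x \<in> topspace X" "p = phi X S x"
    by (auto simp: Xtilde_def)
  have "q = p" if "q \<in> noncompact_elems D" "q \<le> p" for q
    using noncompact_below_above_phi[OF x(1), of p q] that x(2) by simp
  then show "p \<in> minimals (noncompact_elems D)"
    using p Xtilde_subset_R R_subset_noncompact by (auto simp: minimals_def)
qed

text \<open>
  If no sequence \<open>phi X S y\<close> were below \<open>q\<close>, the sets \<open>S k b\<close> for which \<open>b\<close> is not the \<open>k\<close>-th digit of \<open>q\<close>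
  would cover \<open>X\<close>. A finite subcover involves finitely many indices, and a point approximating \<open>q\<close>
  beyond all of them is not covered.
\<close>

lemma compact_noncompact_subset_R:
  assumes X: "compact_space X"
  shows "noncompact_elems D \<subseteq> R"
proof
  fix q assume q: "q \<in> noncompact_elems D"
  have "\<exists>y\<in>topspace X. phi X S y \<le> q"
  proof (rule ccontr)
    assume n: "\<not> ?thesis"
    let ?N = "{(k, b). q k \<noteq> Dig b}"
    let ?S = "\<lambda>(k, b). S k b"
    have cover: "topspace X \<subseteq> \<Union>(?S ` ?N)"
    proof
      fix y assume y: "y \<in> topspace X"
      then obtain k b where "phi X S y k = Dig b" "q k \<noteq> Dig b"
        using n unfolding le_tseq_iff by blast
      then show "y \<in> \<Union>(?S ` ?N)"
        using y by (auto simp: phi_eq_Dig_iff)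
    qed
    have "\<forall>U\<in>?S ` ?N. openin X U"
      by (auto simp: openin_S)
    with cover X obtain \<F> where \<F>: "finite \<F>" "\<F> \<subseteq> ?S ` ?N" "topspace X \<subseteq> \<Union>\<F>"
      unfolding compact_space_alt by meson
    obtain F where "F \<subseteq> ?N" "finite F" "\<F> = ?S ` F"
      using finite_subset_image[OF \<F>(1,2)] by (elim exE conjE)
    with \<F>(3) have F: "finite F" "F \<subseteq> ?N" "topspace X \<subseteq> \<Union>(?S ` F)"
      by simp_all
    obtain n where n: "\<forall>k\<in>fst ` F. k < n"
      using F(1) finite_nat_set_iff_bounded[of "fst ` F"] by blast
    obtain y where y: "y \<in> topspace X" "trunc (phi X S y) n \<le> q"
      using noncompact_approx[OF q] by blast
    obtain k b where kb: "(k, b) \<in> F" "y \<in> S k b"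
      using F(3) y(1) by fastforce
    then have "k < n"
      using n by force
    then have "trunc (phi X S y) n k = Dig b"
      using kb(2) y(1) by (simp add: trunc_def phi_eq_Dig_iff)
    then have "q k = Dig b"
      using y(2) by (simp add: le_tseq_iff)
    then show False
      using F(2) kb(1) by auto
  qed
  then show "q \<in> R"
    using q by (auto simp: up_closure_in_def Xtilde_def noncompact_elems_def)
qed

lemma compact_R_eq: "compact_space X \<Longrightarrow> R = noncompact_elems D"
  using compact_noncompact_subset_R R_subset_noncompact by blast

lemma compact_Xtilde_eq:
  assumes "compact_space X"
  shows "Xtilde X S = minimals (noncompact_elems D)"
proof
  show "minimals (noncompact_elems D) \<subseteq> Xtilde X S"
  proof
    fix p assume p: "p \<in> minimals (noncompact_elems D)"
    then have "p \<in> R"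
      using compact_noncompact_subset_R[OF assms] by (auto simp: minimals_def)
    then obtain q where q: "q \<in> Xtilde X S" "q \<le> p"
      by (auto simp: up_closure_in_def)
    then have "q = p"
      using p Xtilde_subset_R R_subset_noncompact by (auto simp: minimals_def)
    then show "p \<in> Xtilde X S"
      using q by simp
  qed
qed (rule Xtilde_minimal)

lemma topspace_sub: "Q \<subseteq> D \<Longrightarrow> topspace (subtopology (scott_topology D) Q) = Q"
  by auto

lemma R_subset_D: "R \<subseteq> D"
  by (auto simp: up_closure_in_def)

lemma continuous_map_rho: "continuous_map (subtopology (scott_topology D) R) X (rho X S)"
  unfolding continuous_map_def topspace_sub[OF R_subset_D]
proof (intro conjI allI impI)
  show "rho X S \<in> R \<rightarrow> topspace X"
    using rho_eq by (auto elim!: R_cases)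
  fix U assume U: "openin X U"
  show "openin (subtopology (scott_topology D) R) {p \<in> R. rho X S p \<in> U}"
  proof (subst openin_subopen, intro ballI)
    fix p assume "p \<in> {p \<in> R. rho X S p \<in> U}"
    then have p: "p \<in> R" "rho X S p \<in> U"
      by auto
    obtain x where x: "x \<in> topspace X" "phi X S x \<le> p" "p \<in> D"
      using p(1) by (rule R_cases)
    then have "x \<in> U"
      using p(2) rho_eq by simp
    then obtain m where m: "Sclosed X S (trunc (phi X S x) m) \<subseteq> U"
      using Sclosed_trunc_base U by metis
    let ?T = "{q \<in> D. trunc (phi X S x) m \<le> q} \<inter> R"
    have "openin (subtopology (scott_topology D) R) ?T"
      unfolding openin_subtopology openin_scott_topology
      using scott_open_above[OF trunc_in_tfin] by blast
    moreover have "p \<in> ?T"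
      using p(1) x trunc_le order_trans by blast
    moreover have "rho X S q \<in> U" if q: "q \<in> ?T" for q
    proof -
      obtain y where y: "y \<in> topspace X" "phi X S y \<le> q"
        using q by (auto elim: R_cases)
      have "y \<in> Sclosed X S (trunc (phi X S x) m)"
        using above_phi_in_Sclosed[OF y] Sclosed_antimono q by blast
      then show ?thesis
        using m rho_eq[OF y] by auto
    qed
    ultimately show "\<exists>T. openin (subtopology (scott_topology D) R) T \<and> p \<in> T \<and>
        T \<subseteq> {p \<in> R. rho X S p \<in> U}"
      by (intro exI[of _ ?T]) auto
  qed
qed

lemma continuous_map_phi: "continuous_map X (scott_topology D) (phi X S)"
  unfolding continuous_map_def topspace_scott_topology openin_scott_topology
proof (intro conjI allI impI)
  show "phi X S \<in> topspace X \<rightarrow> D"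
    using phi_in_D by blast
  fix U assume U: "scott_open D U"
  show "openin X {x \<in> topspace X. phi X S x \<in> U}"
  proof (subst openin_subopen, intro ballI)
    fix x assume x: "x \<in> {x \<in> topspace X. phi X S x \<in> U}"
    then obtain m where m: "trunc (phi X S x) m \<in> U"
      using scott_open_contains_trunc[OF U] by blast
    let ?T = "Sopen X S (trunc (phi X S x) m)"
    have "x \<in> ?T"
      using x in_Sopen_iff trunc_le by blast
    moreover have "y \<in> topspace X \<and> phi X S y \<in> U" if y: "y \<in> ?T" for y
    proof -
      have yX: "y \<in> topspace X"
        using y by (simp add: Sopen_def)
      then have "trunc (phi X S x) m \<le> phi X S y"
        using y in_Sopen_iff by blast
      then show ?thesis
        using U m yX phi_in_D[OF yX] unfolding scott_open_def by blast
    qed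
    ultimately show "\<exists>T. openin X T \<and> x \<in> T \<and> T \<subseteq> {x \<in> topspace X. phi X S x \<in> U}"
      using openin_Sopen_trunc by (intro exI[of _ ?T]) auto
  qed
qed

text \<open>This is used for both \<open>Q = R\<close> and \<open>Q = Xtilde X S\<close>.\<close>

lemma retraction_maps_rho_phi:
  assumes "Xtilde X S \<subseteq> Q" "Q \<subseteq> R"
  shows "retraction_maps (subtopology (scott_topology D) Q) X (rho X S) (phi X S)"
  unfolding retraction_maps_def
proof (intro conjI ballI)
  show "continuous_map (subtopology (scott_topology D) Q) X (rho X S)"
    using continuous_map_rho assms(2) by (rule continuous_map_from_subtopology_mono)
  show "continuous_map X (subtopology (scott_topology D) Q) (phi X S)"
    using continuous_map_phi assms(1)
    by (auto simp: continuous_map_in_subtopology Xtilde_def)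
  show "rho X S (phi X S x) = x" if "x \<in> topspace X" for x
    using that rho_eq by blast
qed

lemma retract_representation: "retract_domain_representation D R (rho X S) X"
proof -
  have "retraction_map (subtopology (scott_topology D) R) X (rho X S)"
    using retraction_maps_rho_phi[OF Xtilde_subset_R] unfolding retraction_map_def by blast
  then show ?thesis
    using omega_domain_D R_subset_D retraction_imp_quotient_map
    by (auto simp: retract_domain_representation_def domain_representation_def)
qed

lemma Xtilde_dense: "scott_topology D closure_of Xtilde X S = D"
proof
  show "scott_topology D closure_of Xtilde X S \<subseteq> D"
    using closure_of_subset_topspace[of "scott_topology D"] by simp
  show "D \<subseteq> scott_topology D closure_of Xtilde X S"
    unfolding in_closure_of subset_iff topspace_scott_topology openin_scott_topology
  proof (intro allI impI conjI)
    fix p U assume p: "p \<in> D" and U: "p \<in> U \<and> scott_open D U"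
    then obtain m where m: "trunc p m \<in> U"
      using scott_open_contains_trunc by blast
    have "trunc p m \<in> Khat_S X S"
      using p K_subset_Khat D_iff by blast
    then obtain r l x where x: "x \<in> topspace X" "phi X S x \<le> r" "trunc p m = trunc r l"
      by (auto simp: Khat_S_def up_closure_in_def Xtilde_def)
    have "x \<in> Sclosed X S (trunc r l)"
      using above_phi_in_Sclosed[OF x(1,2)] Sclosed_antimono[OF trunc_le] by blast
    then have "x \<in> X closure_of Sopen X S (trunc p m)"
      using proper trunc_in_tfin[of p m] x(3) by (auto simp: proper_dyadic_subbase_def)
    then obtain y where y: "y \<in> Sopen X S (trunc p m)"
      by (auto simp: in_closure_of)
    then have yX: "y \<in> topspace X"
      by (simp add: Sopen_def)
    have "trunc p m \<le> phi X S y"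
      using y yX in_Sopen_iff by blast
    then have "phi X S y \<in> U"
      using U m phi_in_D[OF yX] unfolding scott_open_def by blast
    then show "\<exists>y. y \<in> Xtilde X S \<and> y \<in> U"
      using yX by (auto simp: Xtilde_def)
  qed
qed

lemma dense_representation:
  "dense_domain_representation D (Xtilde X S) (inv_into (topspace X) (phi X S)) X"
proof -
  have XD: "Xtilde X S \<subseteq> D"
    using Xtilde_subset_R R_subset_D by blast
  have "retraction_maps (subtopology (scott_topology D) (Xtilde X S)) X (rho X S) (phi X S)"
    using retraction_maps_rho_phi Xtilde_subset_R by blast
  moreover have "rho X S p = inv_into (topspace X) (phi X S) p" if "p \<in> Xtilde X S" for p
    using that rho_eq by (auto simp: Xtilde_def inv_into_f_f[OF inj_on_phi])
  ultimately have "retraction_maps (subtopology (scott_topology D) (Xtilde X S)) X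
      (inv_into (topspace X) (phi X S)) (phi X S)"
    by (rule retraction_maps_eq) (use XD in auto)
  then have "quotient_map (subtopology (scott_topology D) (Xtilde X S)) X
      (inv_into (topspace X) (phi X S))"
    using retraction_imp_quotient_map unfolding retraction_map_def by blast
  then show ?thesis
    using omega_domain_D XD Xtilde_dense
    by (simp add: dense_domain_representation_def domain_representation_def)
qed

end


section \<open>The two domains\<close>

lemma (in proper_dyadic_space) dyadic_domain_K_S:
  assumes "topspace X \<noteq> {}"
  shows "dyadic_domain X S (K_S X S)"
proof unfold_locales
  show "K_S X S \<subseteq> tfin"
    by (auto simp: K_S_def trunc_in_tfin)
  show "K_S X S \<noteq> {}"
    using assms unfolding K_S_def Xtilde_def by blast
  show "trunc e m \<in> K_S X S" if "e \<in> K_S X S" for e m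
    using that unfolding K_S_def by (clarsimp simp: trunc_trunc) blast
  show "K_S X S \<subseteq> Khat_S X S"
    unfolding K_S_def Khat_S_def up_closure_in_def by blast
qed auto

lemma (in proper_dyadic_space) dyadic_domain_Khat_S:
  assumes "topspace X \<noteq> {}"
  shows "dyadic_domain X S (Khat_S X S)"
proof unfold_locales
  show sub: "K_S X S \<subseteq> Khat_S X S"
    unfolding K_S_def Khat_S_def up_closure_in_def by blast
  show "Khat_S X S \<subseteq> tfin"
    by (auto simp: Khat_S_def trunc_in_tfin)
  show "Khat_S X S \<noteq> {}"
    using assms sub unfolding K_S_def Xtilde_def by blast
  show "trunc e m \<in> Khat_S X S" if "e \<in> Khat_S X S" for e m
    using that unfolding Khat_S_def by (clarsimp simp: trunc_trunc) blast
qed auto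

theorem corollary6p5:
  fixes X :: "'a topology" and S :: "nat \<Rightarrow> bool \<Rightarrow> 'a set" and D :: "tseq set"
  assumes "topspace X \<noteq> {}" and "second_countable X" and "Hausdorff_space X" and "regular_space X"
    and "proper_dyadic_subbase X S"
    and "D = D_S X S \<or> D = Dhat_S X S"
  shows "(dense_domain_representation D (Xtilde X S) (inv_into (topspace X) (phi X S)) X \<and>
          Xtilde X S \<subseteq> minimals (noncompact_elems D) \<and>
          (compact_space X \<longrightarrow> Xtilde X S = minimals (noncompact_elems D))) \<and>
         (retract_domain_representation D (up_closure_in D (Xtilde X S)) (rho X S) X \<and>
          (\<forall>p\<in>up_closure_in D (Xtilde X S). \<forall>q\<in>noncompact_elems D.
              q \<le> p \<longrightarrow> q \<in> up_closure_in D (Xtilde X S)) \<and>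
          (compact_space X \<longrightarrow> up_closure_in D (Xtilde X S) = noncompact_elems D))"
proof -
  interpret proper_dyadic_space X S
    using assms by unfold_locales
  obtain K where K: "dyadic_domain X S K" and D: "D = ideal_completion K"
    using assms(1,6) dyadic_domain_K_S dyadic_domain_Khat_S unfolding D_S_def Dhat_S_def by blast
  interpret dyadic_domain X S K
    by (rule K)
  show ?thesis
    unfolding D
    using dense_representation Xtilde_minimal compact_Xtilde_eq retract_representation
      R_down_closed compact_R_eq by blast
qed

end
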